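(* Let $\mathcal M$ be a unichain Markov decision process with finite state space $S$ and finite action set $A$, and let $\pi_1^{\circ},\pi_2^{\circ}$ be optimal (stationary) policies on $\mathcal M$. Then any combination $\pi$ of these policies, i.e. any policy $\pi:S\to A$ such that for each state $i\in S$ either $\pi(i)=\pi_1^\circ (i)$ or $\pi(i)=\pi_2^\circ (i)$, is optimal as well.
   Context: A Markov decision process (MDP) $\mathcal M$ on a finite state set $S$ with a finite action set $A$ (available in every state) consists of an initial distribution $\mu_0$ on $S$, transition probabilities $p_a(i,j)$ (probability of moving to $j$ when choosing action $a$ in state $i$), and reward distributions with mean $r_a(i)$ for choosing action $a$ in state $i$. A (stationary) policy is a map $\pi:S\to A$; it induces a Markov chain with transition matrix $P=(p_{\pi(i)}(i,j))_{i,j\in S}$. $\mathcal M$ is unichain if for every policy $\pi$ this matrix is irreducible; then it has a unique invariant, strictly positive distribution $\mu$. The average reward of $\pi$ is $V(\pi)=\sum_{i\in S}\mu(i)r_{\pi(i)}(i)$. A policy $\pi^\circ$ is optimal if $V(\pi)\le V(\pi^\circ)$ for all policies $\pi$. *)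

theory Defs
  imports "HOL-Analysis.Analysis" "HOL-Probability.Probability"
begin

text \<open>
  The state set and the action set are the universes of the finite types \<open>'s\<close> and \<open>'a\<close>.
  \<open>mdp_trans M a i\<close> is the distribution of the successor state and \<open>mdp_reward M a i\<close> the
  distribution of the reward when action \<open>a\<close> is chosen in state \<open>i\<close>.
\<close>

record ('s, 'a) mdp =
  mdp_init :: "'s pmf"
  mdp_trans :: "'a \<Rightarrow> 's \<Rightarrow> 's pmf"
  mdp_reward :: "'a \<Rightarrow> 's \<Rightarrow> real measure"

text \<open>
  Integrability is required because the Bochner integral of a non-integrable function is \<open>0\<close>,
  which would not be a mean.
\<close>

definition is_mdp :: "('s::finite, 'a::finite) mdp \<Rightarrow> bool" where
  "is_mdp M \<longleftrightarrow>
    (\<forall>a i. real_distribution (mdp_reward M a i) \<and> integrable (mdp_reward M a i) (\<lambda>x. x))"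

definition mean_reward :: "('s::finite, 'a::finite) mdp \<Rightarrow> 'a \<Rightarrow> 's \<Rightarrow> real" where
  "mean_reward M a i = (\<integral>x. x \<partial>mdp_reward M a i)"

definition policy_matrix ::
    "('s::finite, 'a::finite) mdp \<Rightarrow> ('s \<Rightarrow> 'a) \<Rightarrow> real ^ 's ^ 's" where
  "policy_matrix M \<pi> = (\<chi> i j. pmf (mdp_trans M (\<pi> i) i) j)"

text \<open>
  The product \<open>*\<close> on \<open>real ^ 's ^ 's\<close> is componentwise, so powers with respect to the matrix
  product are written as iterates of \<open>(**) P\<close>.
\<close>

definition irreducible_matrix :: "real ^ 's ^ 's \<Rightarrow> bool" where
  "irreducible_matrix P \<longleftrightarrow> (\<forall>i j. \<exists>n. (((**) P ^^ n) (mat 1)) $ i $ j > 0)"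

definition unichain :: "('s::finite, 'a::finite) mdp \<Rightarrow> bool" where
  "unichain M \<longleftrightarrow> (\<forall>\<pi>. irreducible_matrix (policy_matrix M \<pi>))"

definition invariant_distribution :: "real ^ 's ^ 's \<Rightarrow> real ^ 's \<Rightarrow> bool" where
  "invariant_distribution P \<mu> \<longleftrightarrow>
    (\<forall>i. \<mu> $ i \<ge> 0) \<and> (\<Sum>i\<in>UNIV. \<mu> $ i) = 1 \<and> \<mu> v* P = \<mu>"

text \<open>Meaningful only if the invariant distribution is unique, as it is for unichain \<open>M\<close>.\<close>

definition stationary :: "('s::finite, 'a::finite) mdp \<Rightarrow> ('s \<Rightarrow> 'a) \<Rightarrow> real ^ 's" where
  "stationary M \<pi> = (THE \<mu>. invariant_distribution (policy_matrix M \<pi>) \<mu>)"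

definition average_reward :: "('s::finite, 'a::finite) mdp \<Rightarrow> ('s \<Rightarrow> 'a) \<Rightarrow> real" where
  "average_reward M \<pi> = (\<Sum>i\<in>UNIV. stationary M \<pi> $ i * mean_reward M (\<pi> i) i)"

definition optimal :: "('s::finite, 'a::finite) mdp \<Rightarrow> ('s \<Rightarrow> 'a) \<Rightarrow> bool" where
  "optimal M \<pi>o \<longleftrightarrow> (\<forall>\<pi>. average_reward M \<pi> \<le> average_reward M \<pi>o)"

end

theory Submission
  imports Defs
begin

text \<open>
  Let \<open>g\<close> be the optimal average reward and let \<open>h\<close> solve the Poisson equation
  \<open>r - g = h - P h\<close> for \<open>\<pi>1\<close>. For every policy \<open>\<sigma>\<close> with invariant distribution \<open>\<mu>\<close>,
  \<open>V \<sigma> - g\<close> is the \<open>\<mu>\<close>-average of the advantages \<open>r\<^sub>a(i) + p\<^sub>a h (i) - h(i) - g\<close> of its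
  actions \<open>a = \<sigma> i\<close>. Changing \<open>\<pi>1\<close> in a single state shows that no advantage is positive,
  since invariant distributions are strictly positive; by the same positivity all
  advantages of the optimal policy \<open>\<pi>2\<close> vanish. So do those of any combination.
\<close>

section \<open>Stochastic matrices, their powers and harmonic vectors\<close>

definition stochastic_matrix :: "real ^ 's ^ 's \<Rightarrow> bool" where
  "stochastic_matrix P \<longleftrightarrow> (\<forall>i j. P $ i $ j \<ge> 0) \<and> P *v 1 = 1"

lemma matrix_iterate_nonneg:
  fixes P :: "real ^ 's ^ 's"
  assumes "\<And>i j. P $ i $ j \<ge> 0"
  shows "(((**) P ^^ n) (mat 1)) $ i $ j \<ge> 0"
proof (induction n arbitrary: i j)
  case 0
  then show ?case by (simp add: mat_def)
next
  case (Suc n)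
  then show ?case
    using assms by (auto simp: matrix_matrix_mult_def intro!: sum_nonneg)
qed

lemma matrix_iterate_fixes:
  fixes P :: "real ^ 's ^ 's"
  assumes "P *v h = h"
  shows "((**) P ^^ n) (mat 1) *v h = h"
  by (induction n) (simp_all add: assms flip: matrix_vector_mul_assoc)

lemma matrix_iterate_fixes_left:
  fixes P :: "real ^ 's ^ 's"
  assumes "v v* P = v"
  shows "v v* ((**) P ^^ n) (mat 1) = v"
  by (induction n) (simp_all add: assms flip: vector_matrix_mul_assoc)

text \<open>Minimum principle: \<open>h\<close> minus its minimum is a nonnegative harmonic vector
  that vanishes at a minimizing state \<open>i\<close>. It is fixed by every power of
  \<open>P\<close>, and by irreducibility some power gives each \<open>j\<close> positive weight
  from \<open>i\<close>, so it vanishes at \<open>j\<close> too.\<close>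

lemma harmonic_imp_constant:
  fixes P :: "real ^ 's ^ 's"
  assumes P: "stochastic_matrix P" "irreducible_matrix P" and h: "P *v h = h"
  obtains c where "h = c *\<^sub>R 1"
proof -
  define c where "c = Min (range (($) h))"
  have "c \<in> range (($) h)"
    unfolding c_def by (intro Min_in) auto
  then obtain i where i: "h $ i = c" by auto
  define k where "k = h - c *\<^sub>R 1"
  have k_nonneg: "k $ j \<ge> 0" for j
    by (simp add: k_def c_def)
  have k: "P *v k = k"
    using P(1) h by (simp add: k_def stochastic_matrix_def matrix_vector_mult_diff_distrib
        matrix_vector_mult_scaleR)
  have "k $ j = 0" for j
  proof -
    obtain n where n: "(((**) P ^^ n) (mat 1)) $ i $ j > 0" (is "?Q $ i $ j > 0")
      using P(2) by (auto simp: irreducible_matrix_def)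
    have "?Q $ i $ j * k $ j \<le> (\<Sum>l\<in>UNIV. ?Q $ i $ l * k $ l)"
      using P(1) k_nonneg matrix_iterate_nonneg[of P]
      by (intro member_le_sum) (auto simp: stochastic_matrix_def)
    also have "\<dots> = (?Q *v k) $ i" by (simp add: matrix_vector_mult_def)
    also have "\<dots> = 0" using matrix_iterate_fixes[OF k] i by (simp add: k_def)
    finally show ?thesis
      using n k_nonneg[of j] by (simp add: mult_le_0_iff)
  qed
  then have "h = c *\<^sub>R 1" by (simp add: k_def vec_eq_iff)
  then show ?thesis by (rule that)
qed

section \<open>Invariant distributions and the Poisson equation\<close>

text \<open>Duality moves \<open>P\<close> onto \<open>\<mu>\<close>. Hence
  \<open>h - P *v h\<close> has mean zero under \<open>\<mu>\<close>, which is how \<open>h\<close>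
  cancels later.\<close>

lemma invariant_distribution_inner:
  assumes "invariant_distribution P \<mu>"
  shows "\<mu> \<bullet> (P *v h) = \<mu> \<bullet> h"
  using assms by (simp add: invariant_distribution_def flip: dot_lmul_matrix)

lemma invariant_distribution_inner_1:
  assumes "invariant_distribution P \<mu>"
  shows "\<mu> \<bullet> 1 = 1"
  using assms by (simp add: invariant_distribution_def inner_vec_def)

text \<open>Some state \<open>i\<close> carries mass, and a power of \<open>P\<close> that fixes
  \<open>\<mu>\<close> transports part of it to \<open>j\<close>.\<close>

lemma invariant_distribution_pos:
  fixes P :: "real ^ 's ^ 's"
  assumes P: "stochastic_matrix P" "irreducible_matrix P" and \<mu>: "invariant_distribution P \<mu>"
  shows "\<mu> $ j > 0"
proof -
  have nonneg: "\<mu> $ i \<ge> 0" for i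
    using \<mu> by (simp add: invariant_distribution_def)
  obtain i where "\<mu> $ i \<noteq> 0"
    using \<mu> unfolding invariant_distribution_def by (metis sum.neutral zero_neq_one)
  with nonneg[of i] have i: "\<mu> $ i > 0" by simp
  obtain n where n: "(((**) P ^^ n) (mat 1)) $ i $ j > 0" (is "?Q $ i $ j > 0")
    using P(2) by (auto simp: irreducible_matrix_def)
  have "0 < ?Q $ i $ j * \<mu> $ i" using n i by simp
  also have "\<dots> \<le> (\<Sum>l\<in>UNIV. ?Q $ l $ j * \<mu> $ l)"
    using P(1) nonneg matrix_iterate_nonneg[of P]
    by (intro member_le_sum[where f = "\<lambda>l. ?Q $ l $ j * \<mu> $ l"])
      (auto simp: stochastic_matrix_def)
  also have "\<dots> = (\<mu> v* ?Q) $ j" by (simp add: vector_matrix_mult_def mult.commute)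
  also have "\<dots> = \<mu> $ j"
    using \<mu> by (simp add: invariant_distribution_def matrix_iterate_fixes_left)
  finally show ?thesis .
qed

text \<open>Brouwer's fixed point theorem for \<open>v \<mapsto> v v* P\<close> on the probability
  simplex.\<close>

lemma invariant_distribution_exists:
  fixes P :: "real ^ 's ^ 's"
  assumes P: "stochastic_matrix P"
  obtains \<mu> where "invariant_distribution P \<mu>"
proof -
  define S :: "(real ^ 's) set" where "S = {v. (\<forall>i. v $ i \<ge> 0) \<and> v \<bullet> 1 = 1}"
  have S_eq: "S = {v. \<forall>i. v $ i \<ge> 0} \<inter> {v. v \<bullet> 1 = 1}"
    by (auto simp: S_def)
  have "closed S"
    unfolding S_eq
    by (intro closed_Int closed_Collect_all closed_Collect_le closed_Collect_eq continuous_intros)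
  moreover have "bounded S"
  proof (rule bounded_subset[OF bounded_cbox])
    show "S \<subseteq> cbox 0 1"
    proof
      fix v assume v: "v \<in> S"
      have "v $ i \<le> 1" for i
      proof -
        have "v $ i \<le> (\<Sum>j\<in>UNIV. v $ j)"
          using v by (intro member_le_sum) (auto simp: S_def)
        then show ?thesis using v by (simp add: S_def inner_vec_def)
      qed
      then show "v \<in> cbox 0 1" using v by (simp add: mem_box_cart S_def)
    qed
  qed
  ultimately have "compact S" by (simp add: compact_eq_bounded_closed)
  moreover have "convex S"
    by (auto simp: S_def convex_def inner_add_left)
  \<comment> \<open>The point mass at an arbitrary state.\<close>
  moreover have "axis undefined 1 \<in> S"
    by (simp add: S_def inner_axis') (simp add: axis_def)
  then have "S \<noteq> {}" by auto
  moreover have "continuous_on S (\<lambda>v. v v* P)"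
    by (simp add: vector_matrix_mult_def) (intro continuous_intros)
  moreover have "(\<lambda>v. v v* P) \<in> S \<rightarrow> S"
  proof (rule funcsetI)
    fix v assume v: "v \<in> S"
    then have "(v v* P) $ i \<ge> 0" for i
      using P by (auto simp: S_def stochastic_matrix_def vector_matrix_mult_def intro!: sum_nonneg)
    moreover have "(v v* P) \<bullet> 1 = 1"
      using P v by (simp add: S_def stochastic_matrix_def dot_lmul_matrix)
    ultimately show "v v* P \<in> S" by (simp add: S_def)
  qed
  ultimately obtain \<mu> where "\<mu> \<in> S" "\<mu> v* P = \<mu>"
    by (rule brouwer)
  then have "invariant_distribution P \<mu>"
    by (simp add: S_def invariant_distribution_def inner_vec_def)
  then show ?thesis by (rule that)
qed

text \<open>
  The map \<open>T h = h - P h + (\<mu> \<bullet> h) 1\<close> is injective, hence surjective; pairing \<open>T h = r\<close> with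
  \<open>\<mu>\<close> identifies the constant as \<open>\<mu> \<bullet> r\<close>.
\<close>

lemma poisson_equation:
  fixes P :: "real ^ 's ^ 's"
  assumes P: "stochastic_matrix P" "irreducible_matrix P" and \<mu>: "invariant_distribution P \<mu>"
  obtains h where "r = h - P *v h + (\<mu> \<bullet> r) *\<^sub>R 1"
proof -
  define T where "T h = h - P *v h + (\<mu> \<bullet> h) *\<^sub>R 1" for h
  have \<mu>T: "\<mu> \<bullet> T h = \<mu> \<bullet> h" for h
    using invariant_distribution_inner[OF \<mu>] invariant_distribution_inner_1[OF \<mu>]
    by (simp add: T_def inner_add_right inner_diff_right)
  have lin: "linear T"
    unfolding T_def
    by (rule linearI)
      (simp_all add: algebra_simps inner_add_right matrix_vector_mult_scaleR)
  have "inj T"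
    unfolding linear_injective_0[OF lin]
  proof (intro allI impI)
    fix h assume Th: "T h = 0"
    then have \<mu>h: "\<mu> \<bullet> h = 0" using \<mu>T[of h] by simp
    then have "P *v h = h" using Th by (simp add: T_def)
    then obtain c where "h = c *\<^sub>R 1" by (rule harmonic_imp_constant[OF P])
    then show "h = 0" using \<mu>h invariant_distribution_inner_1[OF \<mu>] by simp
  qed
  with lin have "surj T" by (rule linear_injective_imp_surjective) simp_all
  then obtain h where h: "r = T h" by (rule surjE)
  then have "r = h - P *v h + (\<mu> \<bullet> r) *\<^sub>R 1"
    unfolding h \<mu>T by (simp add: T_def)
  then show ?thesis by (rule that)
qed

text \<open>Pairing the Poisson equation for \<open>\<mu>\<close> with \<open>\<nu>\<close> cancels
  \<open>h\<close> and leaves equal means for every \<open>r\<close>.\<close>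

lemma invariant_distribution_unique:
  fixes P :: "real ^ 's ^ 's"
  assumes P: "stochastic_matrix P" "irreducible_matrix P"
    and \<mu>: "invariant_distribution P \<mu>" and \<nu>: "invariant_distribution P \<nu>"
  shows "\<nu> = \<mu>"
proof -
  have "\<nu> \<bullet> r = \<mu> \<bullet> r" for r
  proof -
    obtain h where "r = h - P *v h + (\<mu> \<bullet> r) *\<^sub>R 1"
      by (rule poisson_equation[OF P \<mu>])
    then have "\<nu> \<bullet> r = \<nu> \<bullet> (h - P *v h + (\<mu> \<bullet> r) *\<^sub>R 1)" by simp
    then show ?thesis
      using invariant_distribution_inner[OF \<nu>] invariant_distribution_inner_1[OF \<nu>]
      by (simp add: inner_add_right inner_diff_right)
  qed
  then show ?thesis using vector_eq_rdot by blast
qed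

section \<open>Stationary distributions and advantages of policies\<close>

lemma stochastic_policy_matrix: "stochastic_matrix (policy_matrix M \<pi>)"
  by (simp add: stochastic_matrix_def policy_matrix_def matrix_vector_mult_def vec_eq_iff
      sum_pmf_eq_1)

lemma invariant_distribution_stationary:
  assumes "unichain M"
  shows "invariant_distribution (policy_matrix M \<pi>) (stationary M \<pi>)"
proof -
  let ?P = "policy_matrix M \<pi>"
  have irr: "irreducible_matrix ?P" using assms by (simp add: unichain_def)
  obtain \<mu> where \<mu>: "invariant_distribution ?P \<mu>"
    by (rule invariant_distribution_exists[OF stochastic_policy_matrix])
  then show ?thesis
    unfolding stationary_def
    by (rule theI)
      (rule invariant_distribution_unique[OF stochastic_policy_matrix irr \<mu>])
qed

lemma stationary_pos:
  assumes "unichain M"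
  shows "stationary M \<pi> $ i > 0"
proof (rule invariant_distribution_pos[OF stochastic_policy_matrix])
  show "irreducible_matrix (policy_matrix M \<pi>)" using assms by (simp add: unichain_def)
  show "invariant_distribution (policy_matrix M \<pi>) (stationary M \<pi>)"
    using assms by (rule invariant_distribution_stationary)
qed

definition policy_reward ::
    "('s::finite, 'a::finite) mdp \<Rightarrow> ('s \<Rightarrow> 'a) \<Rightarrow> real ^ 's" where
  "policy_reward M \<pi> = (\<chi> i. mean_reward M (\<pi> i) i)"

lemma average_reward_inner: "average_reward M \<pi> = stationary M \<pi> \<bullet> policy_reward M \<pi>"
  by (simp add: average_reward_def policy_reward_def inner_vec_def)

text \<open>The defect of the average-reward Bellman equation with gain \<open>g\<close> and bias
  \<open>h\<close>. It depends on an action and a state, not on a policy, so a combination of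
  policies inherits its values state by state.\<close>

definition advantage ::
    "('s::finite, 'a::finite) mdp \<Rightarrow> real \<Rightarrow> real ^ 's \<Rightarrow> 'a \<Rightarrow> 's \<Rightarrow> real" where
  "advantage M g h a i =
    mean_reward M a i + (\<Sum>j\<in>UNIV. pmf (mdp_trans M a i) j * h $ j) - h $ i - g"

lemma advantage_policy:
  "(\<chi> i. advantage M g h (\<pi> i) i) = policy_reward M \<pi> + policy_matrix M \<pi> *v h - h - g *\<^sub>R 1"
  by (simp add: vec_eq_iff advantage_def policy_reward_def policy_matrix_def
      matrix_vector_mult_def)

text \<open>The \<open>h\<close>-terms average to zero under the stationary distribution of
  \<open>\<sigma>\<close>; thus \<open>g\<close> and \<open>h\<close> may come from another
  policy.\<close>

lemma average_reward_diff:
  assumes "unichain M"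
  shows "average_reward M \<sigma> - g = (\<Sum>i\<in>UNIV. stationary M \<sigma> $ i * advantage M g h (\<sigma> i) i)"
proof -
  note inv = invariant_distribution_stationary[OF assms]
  have "(\<Sum>i\<in>UNIV. stationary M \<sigma> $ i * advantage M g h (\<sigma> i) i) =
      stationary M \<sigma> \<bullet> (\<chi> i. advantage M g h (\<sigma> i) i)"
    by (simp add: inner_vec_def)
  also have "\<dots> = average_reward M \<sigma> - g"
    using invariant_distribution_inner[OF inv] invariant_distribution_inner_1[OF inv]
    by (simp add: advantage_policy average_reward_inner inner_add_right inner_diff_right)
  finally show ?thesis by simp
qed

lemma advantage_bias_zero:
  assumes "unichain M"
  obtains h where "\<And>i. advantage M (average_reward M \<pi>) h (\<pi> i) i = 0"
proof -
  have irr: "irreducible_matrix (policy_matrix M \<pi>)" using assms by (simp add: unichain_def)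
  obtain h where h: "policy_reward M \<pi> = h - policy_matrix M \<pi> *v h +
      (stationary M \<pi> \<bullet> policy_reward M \<pi>) *\<^sub>R 1"
    by (rule poisson_equation[OF stochastic_policy_matrix irr
          invariant_distribution_stationary[OF assms]])
  have "(\<chi> i. advantage M (average_reward M \<pi>) h (\<pi> i) i) = 0"
    \<comment> \<open>The right-hand side of \<open>h\<close> contains
      \<open>policy_reward M \<pi>\<close> again, so it is substituted once instead of serving as a
      rewrite rule.\<close>
    unfolding advantage_policy average_reward_inner by (subst h) simp
  then have "advantage M (average_reward M \<pi>) h (\<pi> i) i = 0" for i
    by (simp add: vec_eq_iff)
  then show ?thesis by (rule that)
qed

lemma optimal_advantage_nonpos:
  assumes M: "unichain M" and opt: "optimal M \<pi>"
    and zero: "\<And>i. advantage M (average_reward M \<pi>) h (\<pi> i) i = 0"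
  shows "advantage M (average_reward M \<pi>) h a i \<le> 0"
proof -
  let ?g = "average_reward M \<pi>" and ?\<sigma> = "\<pi>(i := a)"
  have "average_reward M ?\<sigma> - ?g =
      (\<Sum>j\<in>UNIV. stationary M ?\<sigma> $ j * advantage M ?g h (?\<sigma> j) j)"
    by (rule average_reward_diff[OF M])
  \<comment> \<open>Away from \<open>i\<close> the policy \<open>?\<sigma>\<close> agrees with
    \<open>\<pi>\<close>, whose advantages are zero.\<close>
  also have "\<dots> = (\<Sum>j\<in>UNIV. if j = i then stationary M ?\<sigma> $ i * advantage M ?g h a i else 0)"
    by (intro sum.cong) (simp_all add: zero)
  also have "\<dots> = stationary M ?\<sigma> $ i * advantage M ?g h a i"
    by simp
  finally have "stationary M ?\<sigma> $ i * advantage M ?g h a i = average_reward M ?\<sigma> - ?g" ..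
  also have "\<dots> \<le> 0"
    using opt by (simp add: optimal_def)
  finally have "stationary M ?\<sigma> $ i * advantage M ?g h a i \<le> 0" .
  then show ?thesis
    using stationary_pos[OF M, of ?\<sigma> i] by (simp add: mult_le_0_iff)
qed

theorem theorem1:
  fixes M :: "('s::finite, 'a::finite) mdp"
    and \<pi>1 \<pi>2 \<pi> :: "'s \<Rightarrow> 'a"
  assumes "is_mdp M"
    and "unichain M"
    and "optimal M \<pi>1"
    and "optimal M \<pi>2"
    and "\<And>i. \<pi> i = \<pi>1 i \<or> \<pi> i = \<pi>2 i"
  shows "optimal M \<pi>"
proof -
  note M = \<open>unichain M\<close>
  let ?g = "average_reward M \<pi>1"
  obtain h where zero1: "\<And>i. advantage M ?g h (\<pi>1 i) i = 0"
    using advantage_bias_zero[OF M, of \<pi>1] by blast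
  have nonpos: "advantage M ?g h a i \<le> 0" for a i
    using M assms(3) zero1 by (rule optimal_advantage_nonpos)
  have "average_reward M \<pi>2 = ?g"
    using assms(3,4) by (auto simp: optimal_def intro: order_antisym)
  \<comment> \<open>The sign is flipped so that the summands are nonnegative; a zero sum then forces
    each of them to vanish.\<close>
  then have "(\<Sum>i\<in>UNIV. - (stationary M \<pi>2 $ i * advantage M ?g h (\<pi>2 i) i)) = 0"
    using average_reward_diff[OF M, of \<pi>2 ?g h] by (simp add: sum_negf)
  moreover have "- (stationary M \<pi>2 $ i * advantage M ?g h (\<pi>2 i) i) \<ge> 0" for i
    using nonpos[of "\<pi>2 i" i] stationary_pos[OF M, of \<pi>2 i] by (simp add: mult_le_0_iff)
  ultimately have "stationary M \<pi>2 $ i * advantage M ?g h (\<pi>2 i) i = 0" for i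
    by (subst (asm) sum_nonneg_eq_0_iff) auto
  then have zero2: "advantage M ?g h (\<pi>2 i) i = 0" for i
    using stationary_pos[OF M, of \<pi>2 i] by (metis less_irrefl mult_eq_0_iff)
  have "advantage M ?g h (\<pi> i) i = 0" for i
    using assms(5)[of i] zero1[of i] zero2[of i] by auto
  \<comment> \<open>The weights are now those of \<open>\<pi>\<close> itself, but every advantage
    they multiply is zero.\<close>
  then have "average_reward M \<pi> = ?g"
    using average_reward_diff[OF M, of \<pi> ?g h] by simp
  then show ?thesis using assms(3) by (simp add: optimal_def)
qed

end
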